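(* Let $M$ be a metric space of cardinality at least $3$ (with an arbitrary distinguished base point $0\in M$). Then $\mathcal F(M)$ is not rotund.
   Context: All normed spaces are real. Let $(M,\rho,0)$ be a pointed metric space, i.e. a metric space with a distinguished base point $0\in M$. $\mathrm{Lip}_0(M)$ is the Banach space of all real-valued Lipschitz functions $f$ on $M$ with $f(0)=0$, equipped with the norm $\|f\|_{\mathrm{Lip}}=\sup\left\{\frac{|f(x)-f(y)|}{\rho(x,y)} : x,y\in M,\ x\neq y\right\}$. For $x\in M$ let $\delta_x\in \mathrm{Lip}_0(M)^*$ be the evaluation functional $\langle\delta_x,f\rangle=f(x)$. The Lipschitz-free space $\mathcal F(M)$ is the closed linear span of $\{\delta_x : x\in M\}$ in $\mathrm{Lip}_0(M)^*$, with the dual norm. A normed linear space $X$ is rotund if $\|x+y\|<2$ for any $x,y\in S_X$ with $x\neq y$, where $S_X$ is the unit sphere of $X$. *)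

theory Defs
  imports "HOL-Analysis.Analysis"
begin

text \<open>
  A pointed metric space is a type of sort \<open>{metric_space, zero}\<close>. The class \<^class>\<open>zero\<close> has no
  axioms: its constant \<open>0\<close> is an arbitrary point of the space, and no algebraic structure is implied.
\<close>

typedef (overloaded) ('a :: "{metric_space, zero}") lip0 =
  "{f :: 'a \<Rightarrow> real. f 0 = 0 \<and> (\<exists>C. C-lipschitz_on UNIV f)}"
  morphisms lip0_apply Lip0
  by (rule exI[of _ "\<lambda>_. 0"]) (auto intro!: exI[of _ 0] lipschitz_onI)

setup_lifting type_definition_lip0

text \<open>
  The element \<open>0\<close> is inserted only so that the supremum is over a nonempty set when the space has a
  single point; otherwise it changes nothing, the quotients being nonnegative.
\<close>

definition lip_norm :: "('a :: metric_space \<Rightarrow> real) \<Rightarrow> real" where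
  "lip_norm f = Sup (insert 0 {\<bar>f x - f y\<bar> / dist x y | x y. x \<noteq> y})"

lemma lip_norm_bdd:
  assumes "C-lipschitz_on UNIV f"
  shows "bdd_above (insert 0 {\<bar>f x - f y\<bar> / dist x y | x y :: 'a :: metric_space. x \<noteq> y})"
proof -
  have "\<bar>f x - f y\<bar> / dist x y \<le> C" if "x \<noteq> y" for x y
    using lipschitz_onD[OF assms, of x y] that by (simp add: dist_real_def divide_le_eq)
  moreover have "0 \<le> C"
    using assms by (rule lipschitz_on_nonneg)
  ultimately show ?thesis
    by (intro bdd_aboveI[of _ C]) auto
qed

lemma lip_norm_nonneg:
  assumes "C-lipschitz_on UNIV f"
  shows "0 \<le> lip_norm f"
  unfolding lip_norm_def by (rule cSup_upper[OF _ lip_norm_bdd[OF assms]]) simp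

lemma lip_norm_bound:
  assumes "C-lipschitz_on UNIV f"
  shows "\<bar>f x - f y\<bar> \<le> lip_norm f * dist x y"
proof (cases "x = y")
  case False
  then have "\<bar>f x - f y\<bar> / dist x y \<le> lip_norm f"
    unfolding lip_norm_def by (intro cSup_upper[OF _ lip_norm_bdd[OF assms]]) auto
  with False show ?thesis
    by (simp add: divide_le_eq)
qed simp

lemma lip_norm_le:
  assumes "0 \<le> K" and "\<And>x y. \<bar>f x - f y\<bar> \<le> K * dist x y"
  shows "lip_norm f \<le> K"
  unfolding lip_norm_def using assms by (intro cSup_least) (auto simp: divide_le_eq)

instantiation lip0 :: ("{metric_space, zero}") real_normed_vector
begin

lift_definition zero_lip0 :: "'a lip0" is "\<lambda>_. 0"
  by (auto intro!: exI[of _ 0] lipschitz_onI)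

lift_definition plus_lip0 :: "'a lip0 \<Rightarrow> 'a lip0 \<Rightarrow> 'a lip0" is "\<lambda>f g x. f x + g x"
  by (auto intro: lipschitz_on_add)

lift_definition minus_lip0 :: "'a lip0 \<Rightarrow> 'a lip0 \<Rightarrow> 'a lip0" is "\<lambda>f g x. f x - g x"
  by (auto intro: lipschitz_on_diff)

lift_definition uminus_lip0 :: "'a lip0 \<Rightarrow> 'a lip0" is "\<lambda>f x. - f x"
  by (auto intro: lipschitz_on_minus)

lift_definition scaleR_lip0 :: "real \<Rightarrow> 'a lip0 \<Rightarrow> 'a lip0" is "\<lambda>c f x. c * f x"
  by (auto intro: lipschitz_on_cmult_real)

lift_definition norm_lip0 :: "'a lip0 \<Rightarrow> real" is lip_norm .

definition dist_lip0 :: "'a lip0 \<Rightarrow> 'a lip0 \<Rightarrow> real" where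
  "dist_lip0 f g = norm (f - g)"

definition sgn_lip0 :: "'a lip0 \<Rightarrow> 'a lip0" where
  "sgn_lip0 f = inverse (norm f) *\<^sub>R f"

definition uniformity_lip0 :: "('a lip0 \<times> 'a lip0) filter" where
  "uniformity_lip0 = (INF e\<in>{0<..}. principal {(f, g). dist f g < e})"

definition open_lip0 :: "'a lip0 set \<Rightarrow> bool" where
  "open_lip0 U \<longleftrightarrow> (\<forall>f\<in>U. eventually (\<lambda>(f', g). f' = f \<longrightarrow> g \<in> U) uniformity)"

instance
proof
  fix f g h :: "'a lip0" and a b :: real
  show "f + g + h = f + (g + h)" "f + g = g + f" "0 + f = f" "- f + f = 0" "f - g = f + - g"
    by (transfer; simp add: fun_eq_iff)+
  show "a *\<^sub>R (f + g) = a *\<^sub>R f + a *\<^sub>R g" "(a + b) *\<^sub>R f = a *\<^sub>R f + b *\<^sub>R f"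
    "a *\<^sub>R b *\<^sub>R f = (a * b) *\<^sub>R f" "1 *\<^sub>R f = f"
    by (transfer; simp add: fun_eq_iff algebra_simps)+
  show "dist f g = norm (f - g)" by (rule dist_lip0_def)
  show "sgn f = inverse (norm f) *\<^sub>R f" by (rule sgn_lip0_def)
  show "uniformity = (INF e\<in>{0<..}. principal {(f, g :: 'a lip0). dist f g < e})"
    by (rule uniformity_lip0_def)
  show "open U \<longleftrightarrow> (\<forall>f\<in>U. \<forall>\<^sub>F (f', g) in uniformity. f' = f \<longrightarrow> g \<in> U)" for U :: "'a lip0 set"
    by (rule open_lip0_def)
  show "norm f = 0 \<longleftrightarrow> f = 0"
  proof
    assume "norm f = 0"
    then show "f = 0"
    proof transfer
      fix f :: "'a \<Rightarrow> real"
      assume f: "f 0 = 0 \<and> (\<exists>C. C-lipschitz_on UNIV f)" and "lip_norm f = 0"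
      then have "\<bar>f x - f 0\<bar> \<le> 0 * dist x 0" for x
        using lip_norm_bound by metis
      with f show "f = (\<lambda>_. 0)"
        by (simp add: fun_eq_iff)
    qed
  next
    assume "f = 0"
    moreover have "norm (0 :: 'a lip0) = 0"
    proof transfer
      have "0-lipschitz_on UNIV (\<lambda>_ :: 'a. 0 :: real)"
        by (auto intro: lipschitz_onI)
      then show "lip_norm (\<lambda>_ :: 'a. 0 :: real) = 0"
        by (intro antisym lip_norm_le lip_norm_nonneg) auto
    qed
    ultimately show "norm f = 0" by simp
  qed
  show "norm (f + g) \<le> norm f + norm g"
  proof transfer
    fix f g :: "'a \<Rightarrow> real"
    assume "f 0 = 0 \<and> (\<exists>C. C-lipschitz_on UNIV f)" and "g 0 = 0 \<and> (\<exists>C. C-lipschitz_on UNIV g)"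
    then obtain C D where C: "C-lipschitz_on UNIV f" and D: "D-lipschitz_on UNIV g"
      by blast
    show "lip_norm (\<lambda>x. f x + g x) \<le> lip_norm f + lip_norm g"
    proof (rule lip_norm_le)
      show "0 \<le> lip_norm f + lip_norm g"
        using lip_norm_nonneg[OF C] lip_norm_nonneg[OF D] by simp
      show "\<bar>f x + g x - (f y + g y)\<bar> \<le> (lip_norm f + lip_norm g) * dist x y" for x y
        using lip_norm_bound[OF C, of x y] lip_norm_bound[OF D, of x y]
        by (simp add: distrib_right)
    qed
  qed
  show "norm (a *\<^sub>R f) = \<bar>a\<bar> * norm f"
  proof (transfer fixing: a)
    have le: "lip_norm (\<lambda>x. c * f x) \<le> \<bar>c\<bar> * lip_norm f"
      if C: "C-lipschitz_on UNIV f" for c C and f :: "'a \<Rightarrow> real"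
    proof (rule lip_norm_le)
      show "0 \<le> \<bar>c\<bar> * lip_norm f"
        using lip_norm_nonneg[OF C] by simp
      have "\<bar>c * f x - c * f y\<bar> = \<bar>c\<bar> * \<bar>f x - f y\<bar>" for x y
        by (simp add: abs_mult flip: right_diff_distrib)
      then show "\<bar>c * f x - c * f y\<bar> \<le> \<bar>c\<bar> * lip_norm f * dist x y" for x y
        using mult_left_mono[OF lip_norm_bound[OF C, of x y], of "\<bar>c\<bar>"] by (simp add: mult.assoc)
    qed
    fix f :: "'a \<Rightarrow> real"
    assume "f 0 = 0 \<and> (\<exists>C. C-lipschitz_on UNIV f)"
    then obtain C where C: "C-lipschitz_on UNIV f"
      by blast
    show "lip_norm (\<lambda>x. a * f x) = \<bar>a\<bar> * lip_norm f"
    proof (cases "a = 0")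
      case True
      have "0-lipschitz_on UNIV (\<lambda>_ :: 'a. 0 :: real)"
        by (auto intro: lipschitz_onI)
      from lip_norm_nonneg[OF this] True show ?thesis
        using le[OF C, of a] by simp
    next
      case False
      have aC: "(\<bar>a\<bar> * C)-lipschitz_on UNIV (\<lambda>x. a * f x)"
        using C by (rule lipschitz_on_cmult_real)
      have "lip_norm f \<le> \<bar>inverse a\<bar> * lip_norm (\<lambda>x. a * f x)"
        using le[OF aC, of "inverse a"] False by (simp flip: mult.assoc)
      with False have "\<bar>a\<bar> * lip_norm f \<le> lip_norm (\<lambda>x. a * f x)"
        by (simp add: field_simps)
      with le[OF C, of a] show ?thesis by simp
    qed
  qed
qed

end

text \<open>
  The dual of \<open>'a lip0\<close>, with its dual norm, is the type \<open>'a lip0 \<Rightarrow>\<^sub>L real\<close>.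
\<close>

lift_definition lip0_eval :: "'a :: {metric_space, zero} \<Rightarrow> 'a lip0 \<Rightarrow>\<^sub>L real"
  is "\<lambda>x f. lip0_apply f x"
proof -
  fix x :: 'a
  show "bounded_linear (\<lambda>f. lip0_apply f x)"
  proof (rule bounded_linear_intro)
    show "lip0_apply (f + g) x = lip0_apply f x + lip0_apply g x" for f g
      by transfer simp
    show "lip0_apply (c *\<^sub>R f) x = c *\<^sub>R lip0_apply f x" for c f
      by transfer simp
    show "norm (lip0_apply f x) \<le> norm f * dist x 0" for f
    proof transfer
      fix x :: 'a and f :: "'a \<Rightarrow> real"
      assume "f 0 = 0 \<and> (\<exists>C. C-lipschitz_on UNIV f)"
      then show "norm (f x) \<le> lip_norm f * dist x 0"
        using lip_norm_bound[of _ f x 0] by auto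
    qed
  qed
qed

definition lipschitz_free :: "('a :: {metric_space, zero} lip0 \<Rightarrow>\<^sub>L real) set" where
  "lipschitz_free = closure (span (range lip0_eval))"

text \<open>
  Rotundity of a linear subspace under the norm of the ambient space.
\<close>

definition rotund :: "'a :: real_normed_vector set \<Rightarrow> bool" where
  "rotund X \<longleftrightarrow> (\<forall>x \<in> X \<inter> sphere 0 1. \<forall>y \<in> X \<inter> sphere 0 1. x \<noteq> y \<longrightarrow> norm (x + y) < 2)"

end

theory Submission
  imports Defs
begin

text \<open>
  The molecules \<open>(\<delta>\<^sub>x - \<delta>\<^sub>y) / \<rho>(x, y)\<close> with \<open>x \<noteq> y\<close> lie in the unit ball of the free space, and a
  \<open>1\<close>-Lipschitz function whose slope between \<open>x\<close> and \<open>y\<close> equals \<open>1\<close> norms such a molecule. One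
  function can norm several of them: the distance to a point \<open>p\<close> has slope \<open>1\<close> between \<open>p\<close> and
  every other point. With two further points \<open>q\<close> and \<open>r\<close>, the molecules \<open>u\<close> of \<open>(q, p)\<close> and \<open>v\<close>
  of \<open>(r, p)\<close> therefore both take the value \<open>1\<close> at it, whence \<open>\<parallel>u\<parallel> = \<parallel>v\<parallel> = 1\<close> and
  \<open>\<parallel>u + v\<parallel> = 2\<close>. They are different because the distance to the set \<open>{p, q}\<close> is killed by \<open>u\<close>
  but not by \<open>v\<close>. These distance functions need not vanish at the base point, but molecules are
  differences of evaluations, so subtracting a constant from a function moves it into \<open>Lip\<^sub>0\<close>
  without changing its values at them.
\<close>

definition molecule :: "'a :: {metric_space, zero} \<Rightarrow> 'a \<Rightarrow> 'a lip0 \<Rightarrow>\<^sub>L real" where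
  "molecule x y = (1 / dist x y) *\<^sub>R (lip0_eval x - lip0_eval y)"

lemma molecule_apply:
  "blinfun_apply (molecule x y) f = (lip0_apply f x - lip0_apply f y) / dist x y"
  by (simp add: molecule_def blinfun.bilinear_simps lip0_eval.rep_eq)

lemma molecule_in_lipschitz_free: "molecule x y \<in> lipschitz_free"
proof -
  have "molecule x y \<in> span (range lip0_eval)"
    unfolding molecule_def by (intro span_scale span_diff span_base) auto
  then show ?thesis
    unfolding lipschitz_free_def using closure_subset by blast
qed

lemma norm_molecule_le: "norm (molecule x y) \<le> 1"
proof (rule norm_blinfun_bound)
  fix f
  have "\<bar>lip0_apply f x - lip0_apply f y\<bar> \<le> norm f * dist x y"
    using lip0_apply[of f] lip_norm_bound by (auto simp: norm_lip0.rep_eq)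
  then show "norm (blinfun_apply (molecule x y) f) \<le> 1 * norm f"
    by (cases "x = y") (auto simp: molecule_apply abs_divide divide_le_eq)
qed simp

text \<open>
  The distance to a set is \<open>1\<close>-Lipschitz, and so is its translate that vanishes at the base point.
  The empty set is covered as well, since \<open>infdist x {} = 0\<close>.
\<close>

lemma infdist_test_function:
  fixes A :: "'a :: {metric_space, zero} set"
  obtains f where "norm f \<le> 1"
    and "\<And>x y. blinfun_apply (molecule x y) f = (infdist x A - infdist y A) / dist x y"
proof -
  define h where "h x = infdist x A - infdist 0 A" for x
  have h: "\<bar>h x - h y\<bar> \<le> 1 * dist x y" for x y
    using infdist_triangle_abs[of x A y] by (simp add: h_def)
  have "1-lipschitz_on UNIV h"
    using h by (intro lipschitz_onI) (auto simp: dist_real_def)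
  then have apply_Lip0: "lip0_apply (Lip0 h) = h"
    by (intro Lip0_inverse) (auto simp: h_def)
  show thesis
  proof
    show "norm (Lip0 h) \<le> 1"
      unfolding norm_lip0.rep_eq apply_Lip0 by (rule lip_norm_le[OF _ h]) simp
    show "blinfun_apply (molecule x y) (Lip0 h) = (infdist x A - infdist y A) / dist x y" for x y
      by (simp add: molecule_apply apply_Lip0 h_def)
  qed
qed

lemma molecules_to_common_point:
  fixes p q r :: "'a :: {metric_space, zero}"
  assumes "q \<noteq> p" and "r \<noteq> p"
  shows "norm (molecule q p) = 1" and "norm (molecule q p + molecule r p) = 2"
proof -
  obtain f where f: "norm f \<le> 1"
    "\<And>x y. blinfun_apply (molecule x y) f = (infdist x {p} - infdist y {p}) / dist x y"
    using infdist_test_function[of "{p}"] by blast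
  have one: "blinfun_apply (molecule x p) f = 1" if "x \<noteq> p" for x
    using that by (simp add: f(2))
  have value_le: "blinfun_apply w f \<le> norm w" for w :: "'a lip0 \<Rightarrow>\<^sub>L real"
  proof -
    have "blinfun_apply w f \<le> norm w * norm f"
      using norm_blinfun[of w f] by simp
    also have "\<dots> \<le> norm w"
      using mult_left_mono[OF f(1) norm_ge_zero[of w]] by simp
    finally show ?thesis .
  qed
  show "norm (molecule q p) = 1"
    using value_le[of "molecule q p"] one assms norm_molecule_le[of q p] by simp
  have "norm (molecule q p + molecule r p) \<le> 2"
    using norm_triangle_ineq[of "molecule q p" "molecule r p"]
      norm_molecule_le[of q p] norm_molecule_le[of r p] by linarith
  moreover have "2 \<le> norm (molecule q p + molecule r p)"
    using value_le[of "molecule q p + molecule r p"] one assms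
    by (simp add: blinfun.add_left)
  ultimately show "norm (molecule q p + molecule r p) = 2"
    by simp
qed

lemma molecules_to_common_point_distinct:
  fixes p q r :: "'a :: {metric_space, zero}"
  assumes "r \<noteq> p" and "r \<noteq> q"
  shows "molecule q p \<noteq> molecule r p"
proof -
  obtain g where g:
    "\<And>x y. blinfun_apply (molecule x y) g = (infdist x {p, q} - infdist y {p, q}) / dist x y"
    using infdist_test_function[of "{p, q}"] by blast
  have "infdist r {p, q} \<noteq> 0"
    using in_closed_iff_infdist_zero[of "{p, q}" r] assms by simp
  then have "blinfun_apply (molecule q p) g \<noteq> blinfun_apply (molecule r p) g"
    using assms by (simp add: g)
  then show ?thesis
    by auto
qed

theorem proposition2:
  assumes "infinite (UNIV :: 'a set) \<or> card (UNIV :: 'a set) \<ge> 3"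
  shows "\<not> rotund (lipschitz_free :: ('a :: {metric_space, zero} lip0 \<Rightarrow>\<^sub>L real) set)"
proof -
  obtain S :: "'a set" where "card S = 3"
    using assms infinite_arbitrarily_large[of "UNIV :: 'a set" 3]
      obtain_subset_with_card_n[of 3 "UNIV :: 'a set"] by metis
  then obtain p q r :: 'a where "p \<noteq> q" "p \<noteq> r" "q \<noteq> r"
    by (auto simp: card_3_iff)
  then have "norm (molecule q p) = 1" "norm (molecule r p) = 1"
    "norm (molecule q p + molecule r p) = 2" "molecule q p \<noteq> molecule r p"
    using molecules_to_common_point molecules_to_common_point_distinct by metis+
  moreover have "molecule q p \<in> lipschitz_free \<inter> sphere 0 1" "molecule r p \<in> lipschitz_free \<inter> sphere 0 1"
    using calculation molecule_in_lipschitz_free by auto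
  ultimately show ?thesis
    unfolding rotund_def by fastforce
qed

end
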